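(* Let $m\ge1$ be an integer. The operators $\mathfrak a$ and $(\mathfrak b\mathfrak a)^{m-1}\mathfrak b$ are closed densely defined operators on the space $\mathcal F_m$ and their domains coincide: $$\mathrm{Dom}(\mathfrak a)=\mathrm{Dom}\big((\mathfrak b\mathfrak a)^{m-1}\mathfrak b\big)=D,$$ where $$D=\left\{f(z)=\sum_{n=0}^\infty f_nz^n:\ \sum_{n=0}^\infty|f_n|^2(n!)^mn^m<\infty\right\}\subseteq\mathcal F_m .$$ Moreover, the adjoint operator of $\mathfrak a$ in $\mathcal F_m$ is given by $$\mathfrak a^*=(\mathfrak b\mathfrak a)^{m-1}\mathfrak b,\qquad\text{with}\qquad \mathrm{Dom}(\mathfrak a^* )=\mathrm{Dom}\big((\mathfrak b\mathfrak a)^{m-1}\mathfrak b\big)=D.$$ Furthermore, let $\mathcal H$ be a Hilbert space of entire functions in which the polynomials are dense, and let $m\in\mathbb N$. If the adjoint operator of $\mathfrak a$ in $\mathcal H$ is equal to the operator $(\mathfrak b\mathfrak a)^{m-1}\mathfrak b$, i.e., if $$(M_z)^*=\frac{\partial}{\partial z}\left[\sum_{n=0}^{m-1}S(m-1,n)\,z^n\frac{\partial^n}{\partial z^n}\right],$$ then $\mathcal H=\mathcal F_m$ and there exists $c>0$ for which $$\langle f,g\rangle_{\mathcal H}=c\cdot\langle f,g\rangle_{\mathcal F_m},\qquad\forall f,g\in\mathcal H .$$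
   Context: For an integer $m\ge1$, $\mathcal F_m$ denotes the Hilbert space of entire functions $f(z)=\sum_{n=0}^\infty f_nz^n$ with $\sum_{n=0}^\infty|f_n|^2(n!)^m<\infty$, equipped with the inner product $\langle f,g\rangle_{\mathcal F_m}=\sum_{n=0}^\infty f_n\overline{g_n}(n!)^m$. $\mathfrak a=M_z$ is multiplication by the variable $z$ and $\mathfrak b=\frac{\partial}{\partial z}$ is differentiation; both act on polynomials and, more generally, on entire functions. As operators in a Hilbert space $\mathcal K$ of entire functions ($\mathcal K=\mathcal F_m$ or $\mathcal K=\mathcal H$), they are taken on their natural (maximal) domains: $\mathrm{Dom}(\mathfrak a)=\{f\in\mathcal K:\mathfrak af\in\mathcal K\}$ and $\mathrm{Dom}((\mathfrak b\mathfrak a)^{m-1}\mathfrak b)=\{f\in\mathcal K:(\mathfrak b\mathfrak a)^{m-1}\mathfrak bf\in\mathcal K\}$. The Stirling numbers of the second kind $S(k,n)$, $k,n\in\mathbb N_0=\{0,1,2,\dots\}$, are defined by $S(k,n)=nS(k-1,n)+S(k-1,n-1)$ for $k,n\ge1$, with $S(k,0)=\delta_{k,0}$ and $S(k,n)=0$ if $k<n$. $\mathbb N=\{1,2,\dots\}$.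
   Formalization: In the uniqueness part, the Hilbert space of entire functions H is additionally required to have bounded point evaluations; without any link between norm and function values the uniqueness claim fails (by a choice-based counterexample). *)

theory Defs
  imports "HOL-Complex_Analysis.Complex_Analysis" "HOL-Combinatorics.Stirling"
begin

definition hnorm :: "((complex \<Rightarrow> complex) \<Rightarrow> (complex \<Rightarrow> complex) \<Rightarrow> complex) \<Rightarrow> (complex \<Rightarrow> complex) \<Rightarrow> real"
  where "hnorm ip f = sqrt (Re (ip f f))"

(* The inner product is linear in the first and conjugate-linear in the second argument; only its
   values on H matter.  As usual for Hilbert spaces of functions, point evaluations are required to
   be bounded: without this the Hilbert structure would be unrelated to the functions as such (any
   linear injection of a Hilbert space into the entire functions would be admitted). *)
locale entire_hilbert_space =
  fixes H :: "(complex \<Rightarrow> complex) set"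
    and ip :: "(complex \<Rightarrow> complex) \<Rightarrow> (complex \<Rightarrow> complex) \<Rightarrow> complex"
  assumes entire: "f \<in> H \<Longrightarrow> f holomorphic_on UNIV"
    and zero_mem: "(\<lambda>z. 0) \<in> H"
    and add_mem: "f \<in> H \<Longrightarrow> g \<in> H \<Longrightarrow> (\<lambda>z. f z + g z) \<in> H"
    and scale_mem: "f \<in> H \<Longrightarrow> (\<lambda>z. c * f z) \<in> H"
    and ip_add_left: "f \<in> H \<Longrightarrow> g \<in> H \<Longrightarrow> h \<in> H \<Longrightarrow> ip (\<lambda>z. f z + g z) h = ip f h + ip g h"
    and ip_scale_left: "f \<in> H \<Longrightarrow> g \<in> H \<Longrightarrow> ip (\<lambda>z. c * f z) g = c * ip f g"
    and ip_commute: "f \<in> H \<Longrightarrow> g \<in> H \<Longrightarrow> ip g f = cnj (ip f g)"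
    and ip_pos: "f \<in> H \<Longrightarrow> f \<noteq> (\<lambda>z. 0) \<Longrightarrow> Re (ip f f) > 0"
    and complete: "(\<And>n. F n \<in> H) \<Longrightarrow>
      (\<And>e. e > 0 \<Longrightarrow> \<exists>N. \<forall>j\<ge>N. \<forall>k\<ge>N. hnorm ip (\<lambda>z. F j z - F k z) < e) \<Longrightarrow>
      \<exists>f\<in>H. (\<lambda>n. hnorm ip (\<lambda>z. F n z - f z)) \<longlonglongrightarrow> 0"
    and bounded_evaluation: "\<exists>C. \<forall>f\<in>H. norm (f w) \<le> C * hnorm ip f"

definition dense_in :: "(complex \<Rightarrow> complex) set \<Rightarrow> ((complex \<Rightarrow> complex) \<Rightarrow> (complex \<Rightarrow> complex) \<Rightarrow> complex) \<Rightarrow> (complex \<Rightarrow> complex) set \<Rightarrow> bool"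
  where "dense_in H ip A \<longleftrightarrow> A \<subseteq> H \<and> (\<forall>f\<in>H. \<forall>e>0. \<exists>g\<in>A. hnorm ip (\<lambda>z. f z - g z) < e)"

definition polynomial_functions :: "(complex \<Rightarrow> complex) set"
  where "polynomial_functions = range poly"

text \<open>Unbounded operators in a space \<open>H\<close> are represented by their graphs, so that equality of
  operators includes equality of the domains, and the domain of \<open>T\<close> is \<open>Domain T\<close>.\<close>

type_synonym operator_graph = "((complex \<Rightarrow> complex) \<times> (complex \<Rightarrow> complex)) set"

definition max_operator :: "(complex \<Rightarrow> complex) set \<Rightarrow> ((complex \<Rightarrow> complex) \<Rightarrow> (complex \<Rightarrow> complex)) \<Rightarrow> operator_graph"
  where "max_operator H T = {(f, T f) | f. f \<in> H \<and> T f \<in> H}"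

definition densely_defined :: "(complex \<Rightarrow> complex) set \<Rightarrow> ((complex \<Rightarrow> complex) \<Rightarrow> (complex \<Rightarrow> complex) \<Rightarrow> complex) \<Rightarrow> operator_graph \<Rightarrow> bool"
  where "densely_defined H ip T \<longleftrightarrow> dense_in H ip (Domain T)"

definition closed_operator :: "(complex \<Rightarrow> complex) set \<Rightarrow> ((complex \<Rightarrow> complex) \<Rightarrow> (complex \<Rightarrow> complex) \<Rightarrow> complex) \<Rightarrow> operator_graph \<Rightarrow> bool"
  where "closed_operator H ip T \<longleftrightarrow>
    (\<forall>F G f g. (\<forall>n::nat. (F n, G n) \<in> T) \<and> f \<in> H \<and> g \<in> H \<and>
       (\<lambda>n. hnorm ip (\<lambda>z. F n z - f z)) \<longlonglongrightarrow> 0 \<and>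
       (\<lambda>n. hnorm ip (\<lambda>z. G n z - g z)) \<longlonglongrightarrow> 0 \<longrightarrow> (f, g) \<in> T)"

(* Single-valued, hence the graph of an operator, whenever T is densely defined. *)
definition adjoint_operator :: "(complex \<Rightarrow> complex) set \<Rightarrow> ((complex \<Rightarrow> complex) \<Rightarrow> (complex \<Rightarrow> complex) \<Rightarrow> complex) \<Rightarrow> operator_graph \<Rightarrow> operator_graph"
  where "adjoint_operator H ip T =
    {(g, h). g \<in> H \<and> h \<in> H \<and> (\<forall>(f, Tf) \<in> T. ip Tf g = ip f h)}"

definition taylor_coeff :: "(complex \<Rightarrow> complex) \<Rightarrow> nat \<Rightarrow> complex"
  where "taylor_coeff f n = (deriv ^^ n) f 0 / fact n"

definition fock_space :: "nat \<Rightarrow> (complex \<Rightarrow> complex) set"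
  where "fock_space m = {f. f holomorphic_on UNIV \<and>
    summable (\<lambda>n. (norm (taylor_coeff f n))\<^sup>2 * (fact n) ^ m)}"

definition fock_ip :: "nat \<Rightarrow> (complex \<Rightarrow> complex) \<Rightarrow> (complex \<Rightarrow> complex) \<Rightarrow> complex"
  where "fock_ip m f g = (\<Sum>n. taylor_coeff f n * cnj (taylor_coeff g n) * (fact n) ^ m)"

definition fock_domain :: "nat \<Rightarrow> (complex \<Rightarrow> complex) set"
  where "fock_domain m = {f. f holomorphic_on UNIV \<and>
    summable (\<lambda>n. (norm (taylor_coeff f n))\<^sup>2 * (fact n) ^ m * (real n) ^ m)}"

definition mult_z :: "(complex \<Rightarrow> complex) \<Rightarrow> (complex \<Rightarrow> complex)"
  where "mult_z f = (\<lambda>z. z * f z)"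

definition ba_power_b :: "nat \<Rightarrow> (complex \<Rightarrow> complex) \<Rightarrow> (complex \<Rightarrow> complex)"
  where "ba_power_b m = ((deriv \<circ> mult_z) ^^ (m - 1)) \<circ> deriv"

definition stirling_operator :: "nat \<Rightarrow> (complex \<Rightarrow> complex) \<Rightarrow> (complex \<Rightarrow> complex)"
  where "stirling_operator m f =
    deriv (\<lambda>z. \<Sum>n=0..m-1. of_nat (Stirling (m - 1) n) * z ^ n * (deriv ^^ n) f z)"

end

theory Submission
  imports Defs
begin

text \<open>On Taylor coefficients \<open>\<aa>\<close> is the shift and \<open>(\<bb>\<aa>)\<^sup>m\<^sup>-\<^sup>1\<bb>\<close> is the weighted backward shift
  \<open>f\<^sub>n \<mapsto> (n+1)\<^sup>m f\<^sub>n\<^sub>+\<^sub>1\<close>, so that on the weighted sequence space \<open>\<F>\<^sub>m\<close> domains, closedness and the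
  adjoint can be read off coefficientwise.  Conversely, if the adjoint of \<open>\<aa>\<close> in \<open>\<H>\<close> is this backward
  shift, then the monomials are orthogonal in \<open>\<H>\<close> with norms proportional to those in \<open>\<F>\<^sub>m\<close>.
  Since polynomials are dense, orthogonal expansions converge in \<open>\<H>\<close>; since point evaluations are
  bounded, they are the Taylor expansions.\<close>

section \<open>Taylor coefficients\<close>

lemma fps_nth_eq_taylor_coeff: "f has_fps_expansion F \<Longrightarrow> fps_nth F n = taylor_coeff f n"
  by (simp add: fps_nth_fps_expansion taylor_coeff_def)

lemma has_fps_expansion_taylor:
  assumes "f holomorphic_on UNIV"
  shows "f has_fps_expansion Abs_fps (taylor_coeff f)"
proof -
  have "f has_fps_expansion fps_expansion f 0"
    using assms by (intro has_fps_expansion_fps_expansion[of UNIV]) auto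
  moreover have "fps_expansion f 0 = Abs_fps (taylor_coeff f)"
    by (simp add: fps_eq_iff fps_expansion_def taylor_coeff_def)
  ultimately show ?thesis by simp
qed

lemma taylor_sums:
  assumes "f holomorphic_on UNIV"
  shows "(\<lambda>n. taylor_coeff f n * z ^ n) sums f z"
proof -
  have "f holomorphic_on ball 0 (norm z + 1)"
    using assms holomorphic_on_subset by blast
  from holomorphic_power_series[OF this, of z] show ?thesis
    by (simp add: taylor_coeff_def)
qed

text \<open>The everywhere convergent series itself supplies the analyticity of \<open>f\<close>, so
  exhibiting a power series suffices to read off coefficients. This also identifies norm limits in
  the abstract space later on.\<close>

lemma taylor_coeff_unique:
  assumes "\<And>z. (\<lambda>n. b n * z ^ n) sums f z"
  shows "taylor_coeff f n = b n"
proof -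
  have "f has_fps_expansion Abs_fps b"
    using assms by (intro has_fps_expansionI always_eventually) auto
  then show ?thesis using fps_nth_eq_taylor_coeff by fastforce
qed

lemma entire_eqI:
  assumes "f holomorphic_on UNIV" "g holomorphic_on UNIV"
    and "\<And>n. taylor_coeff f n = taylor_coeff g n"
  shows "f = g"
proof
  fix z
  show "f z = g z"
    using taylor_sums[OF assms(1), of z] taylor_sums[OF assms(2), of z] assms(3)
    by (simp add: sums_unique2)
qed

lemma taylor_coeff_diff:
  assumes "f holomorphic_on UNIV" "g holomorphic_on UNIV"
  shows "taylor_coeff (\<lambda>z. f z - g z) n = taylor_coeff f n - taylor_coeff g n"
  by (rule taylor_coeff_unique)
    (use sums_diff[OF taylor_sums[OF assms(1)] taylor_sums[OF assms(2)]] in \<open>simp add: algebra_simps\<close>)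

lemma mult_z_entire: "f holomorphic_on UNIV \<Longrightarrow> mult_z f holomorphic_on UNIV"
  unfolding mult_z_def by (intro holomorphic_intros) auto

lemma taylor_coeff_mult_z:
  assumes "f holomorphic_on UNIV"
  shows "taylor_coeff (mult_z f) 0 = 0" "taylor_coeff (mult_z f) (Suc n) = taylor_coeff f n"
proof -
  have "mult_z f has_fps_expansion fps_X * Abs_fps (taylor_coeff f)"
    unfolding mult_z_def
    by (intro fps_expansion_intros has_fps_expansion_taylor assms)
  note * = fps_nth_eq_taylor_coeff[OF this]
  show "taylor_coeff (mult_z f) 0 = 0" "taylor_coeff (mult_z f) (Suc n) = taylor_coeff f n"
    using *[of 0] *[of "Suc n"] by simp_all
qed

lemma deriv_entire: "f holomorphic_on UNIV \<Longrightarrow> deriv f holomorphic_on UNIV"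
  by (intro holomorphic_intros) auto

lemma taylor_coeff_deriv:
  assumes "f holomorphic_on UNIV"
  shows "taylor_coeff (deriv f) n = of_nat (Suc n) * taylor_coeff f (Suc n)"
proof -
  have "deriv f has_fps_expansion fps_deriv (Abs_fps (taylor_coeff f))"
    by (intro fps_expansion_intros has_fps_expansion_taylor assms)
  from fps_nth_eq_taylor_coeff[OF this, of n] show ?thesis by simp
qed

text \<open>Multiplying by z shifts coefficients up and differentiating shifts them back, so each
  factor is diagonal with eigenvalue n + 1 on z^n. Holomorphy goes through the same induction
  because the coefficient rules for the next factor require it.\<close>

lemma deriv_mult_z_power:
  assumes "f holomorphic_on UNIV"
  shows "((deriv \<circ> mult_z) ^^ k) f holomorphic_on UNIV \<and>
    taylor_coeff (((deriv \<circ> mult_z) ^^ k) f) n = of_nat (Suc n) ^ k * taylor_coeff f n"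
proof (induction k arbitrary: n)
  case 0
  then show ?case using assms by simp
next
  case (Suc k)
  then show ?case
    by (simp add: deriv_entire mult_z_entire taylor_coeff_deriv taylor_coeff_mult_z del: of_nat_Suc)
qed

lemma ba_power_b_entire: "f holomorphic_on UNIV \<Longrightarrow> ba_power_b m f holomorphic_on UNIV"
  by (simp add: ba_power_b_def deriv_mult_z_power deriv_entire)

text \<open>The innermost derivative gives the shift and one factor n + 1; the m - 1 diagonal
  factors give the others. Since \<open>m - 1\<close> is truncated subtraction, the total exponent
  is m only for m at least 1.\<close>

lemma taylor_coeff_ba_power_b:
  assumes "f holomorphic_on UNIV" "m \<ge> 1"
  shows "taylor_coeff (ba_power_b m f) n = of_nat (Suc n) ^ m * taylor_coeff f (Suc n)"
proof -
  have "taylor_coeff (ba_power_b m f) n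
      = of_nat (Suc n) ^ (m - 1) * (of_nat (Suc n) * taylor_coeff f (Suc n))"
    using assms(1) by (simp add: ba_power_b_def deriv_mult_z_power deriv_entire taylor_coeff_deriv del: of_nat_Suc)
  also have "\<dots> = of_nat (Suc n) ^ Suc (m - 1) * taylor_coeff f (Suc n)" by simp
  also have "Suc (m - 1) = m" using assms(2) by simp
  finally show ?thesis .
qed

text \<open>Applying z d/dz to z^n f^(n) yields n z^n f^(n) + z^(n+1) f^(n+1). Collecting equal
  powers of z reproduces the Stirling recurrence.\<close>

lemma theta_power_eq_Stirling:
  assumes "f holomorphic_on UNIV"
  shows "((mult_z \<circ> deriv) ^^ k) f = (\<lambda>z. \<Sum>n=0..k. of_nat (Stirling k n) * z ^ n * (deriv ^^ n) f z)"
proof (induction k)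
  case 0
  then show ?case by simp
next
  case (Suc k)
  let ?S = "\<lambda>n. of_nat (Stirling k n) :: complex"
  let ?d = "\<lambda>n. (deriv ^^ n) f"
  have step: "((\<lambda>z. \<Sum>n=0..k. ?S n * z ^ n * ?d n z) has_field_derivative
      (\<Sum>n=0..k. ?S n * (of_nat n * z ^ (n - 1) * ?d n z + z ^ n * ?d (Suc n) z))) (at z)" for z
  proof (rule DERIV_sum)
    fix n
    have "?d n holomorphic_on UNIV"
      by (intro holomorphic_higher_deriv assms) auto
    then have "(?d n has_field_derivative ?d (Suc n) z) (at z)"
      by (simp add: holomorphic_derivI)
    then show "((\<lambda>z. ?S n * z ^ n * ?d n z) has_field_derivative
        ?S n * (of_nat n * z ^ (n - 1) * ?d n z + z ^ n * ?d (Suc n) z)) (at z)"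
      by (auto intro!: derivative_eq_intros simp: algebra_simps)
  qed
  show ?case
  proof
    fix z
    let ?t = "\<lambda>n. z ^ n * ?d n z"
    have "((mult_z \<circ> deriv) ^^ Suc k) f z =
        z * (\<Sum>n=0..k. ?S n * (of_nat n * z ^ (n - 1) * ?d n z + z ^ n * ?d (Suc n) z))"
      by (simp add: Suc mult_z_def DERIV_imp_deriv[OF step])
    also have "\<dots> = (\<Sum>n=0..k. ?S n * of_nat n * ?t n + ?S n * ?t (Suc n))"
      unfolding sum_distrib_left
    proof (rule sum.cong[OF refl])
      fix n
      show "z * (?S n * (of_nat n * z ^ (n - 1) * ?d n z + z ^ n * ?d (Suc n) z)) =
        ?S n * of_nat n * ?t n + ?S n * ?t (Suc n)"
        \<comment> \<open>For n = 0 the truncated exponent \<open>n - 1\<close> is 0 instead of -1;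
          the factor \<open>of_nat n\<close> removes that term.\<close>
        by (cases n) (simp_all add: algebra_simps)
    qed
    also have "\<dots> = (\<Sum>n=0..k. ?S n * of_nat n * ?t n) + (\<Sum>n=0..k. ?S n * ?t (Suc n))"
      by (rule sum.distrib)
    \<comment> \<open>The new top term vanishes because \<open>Stirling k (Suc k)\<close> is 0, and
      next the term n = 0 drops out through its factor n. Both sums then run over
      \<open>?t (Suc n)\<close> and merge by the recurrence.\<close>
    also have "(\<Sum>n=0..k. ?S n * of_nat n * ?t n) = (\<Sum>n=0..Suc k. ?S n * of_nat n * ?t n)"
      by simp
    also have "\<dots> = (\<Sum>n=0..k. ?S (Suc n) * of_nat (Suc n) * ?t (Suc n))"
      by (subst sum.atLeast0_atMost_Suc_shift) simp
    also have "\<dots> + (\<Sum>n=0..k. ?S n * ?t (Suc n)) =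
        (\<Sum>n=0..k. of_nat (Stirling (Suc k) (Suc n)) * ?t (Suc n))"
      by (simp add: sum.distrib[symmetric] algebra_simps)
    also have "\<dots> = (\<Sum>n=0..Suc k. of_nat (Stirling (Suc k) n) * ?t n)"
      by (simp only: sum.atLeast0_atMost_Suc_shift) simp
    finally show "((mult_z \<circ> deriv) ^^ Suc k) f z =
        (\<Sum>n=0..Suc k. of_nat (Stirling (Suc k) n) * z ^ n * ?d n z)"
      by (simp only: mult.assoc)
  qed
qed

text \<open>Regrouping the alternating word gives (ba)^k b = b (ab)^k, and (ab)^k has just been
  expanded in Stirling numbers.\<close>

lemma ba_power_b_eq_stirling_operator:
  assumes "f holomorphic_on UNIV"
  shows "ba_power_b m f = stirling_operator m f"
proof -
  have "((deriv \<circ> mult_z) ^^ k) (deriv f) = deriv (((mult_z \<circ> deriv) ^^ k) f)" for k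
    by (induction k) simp_all
  then show ?thesis
    by (simp add: ba_power_b_def stirling_operator_def theta_power_eq_Stirling[OF assms])
qed

text \<open>Coefficients come from an infinite sequence cut off at \<open>N\<close>, so one notion
  covers monomials, polynomials and the partial sums of Taylor and Fourier series.\<close>

definition power_sum :: "(nat \<Rightarrow> complex) \<Rightarrow> nat \<Rightarrow> complex \<Rightarrow> complex"
  where "power_sum b N = (\<lambda>z. \<Sum>n<N. b n * z ^ n)"

lemma power_sum_entire: "power_sum b N holomorphic_on UNIV"
  unfolding power_sum_def by (intro holomorphic_intros)

lemma taylor_coeff_power_sum: "taylor_coeff (power_sum b N) n = (if n < N then b n else 0)"
proof (rule taylor_coeff_unique)
  fix z
  have "(\<lambda>n. if n \<in> {..<N} then b n * z ^ n else 0) sums power_sum b N z"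
    unfolding power_sum_def by (rule sums_If_finite_set) simp
  then show "(\<lambda>n. (if n < N then b n else 0) * z ^ n) sums power_sum b N z"
    by (simp add: if_distrib[of "\<lambda>x. x * _"] cong: if_cong)
qed

lemma power_eq_power_sum: "(\<lambda>z. z ^ k) = power_sum (\<lambda>n. if n = k then 1 else 0) (Suc k)"
  by (auto simp: power_sum_def fun_eq_iff)

lemma taylor_coeff_power: "taylor_coeff (\<lambda>z. z ^ k) n = (if n = k then 1 else 0)"
  unfolding power_eq_power_sum taylor_coeff_power_sum by auto

lemma poly_eq_power_sum: "poly p = power_sum (coeff p) (Suc (degree p))"
  by (simp add: power_sum_def fun_eq_iff poly_altdef lessThan_Suc_atMost)

section \<open>The operators on the weighted Fock space\<close>

lemma fock_spaceD:
  assumes "f \<in> fock_space m"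
  shows "f holomorphic_on UNIV" "summable (\<lambda>n. (norm (taylor_coeff f n))\<^sup>2 * fact n ^ m)"
  using assms by (auto simp: fock_space_def)

lemma norm_diff_sq_le: "(norm (x - y))\<^sup>2 \<le> 2 * (norm x)\<^sup>2 + 2 * (norm y)\<^sup>2"
  for x y :: complex
proof -
  have "(norm (x - y))\<^sup>2 \<le> (norm x + norm y)\<^sup>2"
    by (intro power_mono norm_triangle_ineq4) auto
  also have "\<dots> \<le> 2 * (norm x)\<^sup>2 + 2 * (norm y)\<^sup>2"
    using sum_squares_bound[of "norm x" "norm y"] by (simp add: power2_sum)
  finally show ?thesis .
qed

lemma fock_space_diff:
  assumes "f \<in> fock_space m" "g \<in> fock_space m"
  shows "(\<lambda>z. f z - g z) \<in> fock_space m"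
proof -
  note f = fock_spaceD[OF assms(1)] and g = fock_spaceD[OF assms(2)]
  have "summable (\<lambda>n. (norm (taylor_coeff f n - taylor_coeff g n))\<^sup>2 * fact n ^ m)"
  proof (rule summable_comparison_test')
    show "summable (\<lambda>n. 2 * ((norm (taylor_coeff f n))\<^sup>2 * fact n ^ m)
        + 2 * ((norm (taylor_coeff g n))\<^sup>2 * fact n ^ m))"
      by (intro summable_add summable_mult f g)
    fix n :: nat assume "n \<ge> 0"
    show "norm ((norm (taylor_coeff f n - taylor_coeff g n))\<^sup>2 * fact n ^ m)
      \<le> 2 * ((norm (taylor_coeff f n))\<^sup>2 * fact n ^ m)
        + 2 * ((norm (taylor_coeff g n))\<^sup>2 * fact n ^ m)"
      using mult_right_mono[OF norm_diff_sq_le, of "fact n ^ m" "taylor_coeff f n" "taylor_coeff g n"]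
      by (simp add: algebra_simps)
  qed
  then show ?thesis
    using f g by (auto simp: fock_space_def taylor_coeff_diff intro!: holomorphic_intros)
qed

lemma mult_cnj_of_real: "x * cnj x * of_real w = of_real ((norm x)\<^sup>2 * w)"
  by (simp only: complex_norm_square of_real_mult)

lemma Re_fock_ip_self:
  assumes "f \<in> fock_space m"
  shows "Re (fock_ip m f f) = (\<Sum>n. (norm (taylor_coeff f n))\<^sup>2 * fact n ^ m)"
proof -
  have "fock_ip m f f = (\<Sum>n. complex_of_real ((norm (taylor_coeff f n))\<^sup>2 * fact n ^ m))"
    unfolding fock_ip_def mult_cnj_of_real[symmetric] by simp
  then show ?thesis
    using suminf_of_real[OF fock_spaceD(2)[OF assms], where 'a = complex] by (metis Re_complex_of_real)
qed

lemma Re_fock_ip_self_nonneg: "f \<in> fock_space m \<Longrightarrow> Re (fock_ip m f f) \<ge> 0"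
  using suminf_nonneg[OF fock_spaceD(2)] by (simp add: Re_fock_ip_self)

lemma fock_hnorm_sq:
  assumes "f \<in> fock_space m"
  shows "(hnorm (fock_ip m) f)\<^sup>2 = (\<Sum>n. (norm (taylor_coeff f n))\<^sup>2 * fact n ^ m)"
  using Re_fock_ip_self_nonneg[OF assms] by (simp add: hnorm_def Re_fock_ip_self[OF assms])

lemma hnorm_fock_nonneg: "f \<in> fock_space m \<Longrightarrow> hnorm (fock_ip m) f \<ge> 0"
  by (simp add: hnorm_def Re_fock_ip_self_nonneg)

text \<open>The weights n!^m are at least 1, so a single term of the norm series already dominates
  the coefficient. Hence coefficient functionals are continuous, which is what closedness
  needs.\<close>

lemma norm_taylor_coeff_le_hnorm:
  assumes "f \<in> fock_space m"
  shows "norm (taylor_coeff f n) \<le> hnorm (fock_ip m) f"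
proof (rule power2_le_imp_le)
  have "(norm (taylor_coeff f n))\<^sup>2 * 1 \<le> (norm (taylor_coeff f n))\<^sup>2 * fact n ^ m"
    by (intro mult_left_mono one_le_power) auto
  also have "\<dots> \<le> (\<Sum>n. (norm (taylor_coeff f n))\<^sup>2 * fact n ^ m)"
    using sum_le_suminf[OF fock_spaceD(2)[OF assms], of "{n}"] by simp
  finally show "(norm (taylor_coeff f n))\<^sup>2 \<le> (hnorm (fock_ip m) f)\<^sup>2"
    by (simp add: fock_hnorm_sq[OF assms])
qed (rule hnorm_fock_nonneg[OF assms])

lemma fock_convergence_imp_coeff:
  assumes "\<And>j. F j \<in> fock_space m" "f \<in> fock_space m"
    and "(\<lambda>j. hnorm (fock_ip m) (\<lambda>z. F j z - f z)) \<longlonglongrightarrow> 0"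
  shows "(\<lambda>j. taylor_coeff (F j) n) \<longlonglongrightarrow> taylor_coeff f n"
proof (rule LIM_zero_cancel, rule Lim_null_comparison[OF always_eventually assms(3)], rule allI)
  fix j
  show "norm (taylor_coeff (F j) n - taylor_coeff f n) \<le> hnorm (fock_ip m) (\<lambda>z. F j z - f z)"
    using norm_taylor_coeff_le_hnorm[OF fock_space_diff[OF assms(1,2), of j], of n]
    by (simp add: taylor_coeff_diff fock_spaceD(1)[OF assms(1)] fock_spaceD(1)[OF assms(2)])
qed

lemma summable_fock_ip:
  assumes "f \<in> fock_space m" "g \<in> fock_space m"
  shows "summable (\<lambda>n. taylor_coeff f n * cnj (taylor_coeff g n) * fact n ^ m)"
proof (rule summable_comparison_test')
  let ?a = "\<lambda>f n. (norm (taylor_coeff f n))\<^sup>2 * fact n ^ m :: real"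
  show "summable (\<lambda>n. ?a f n + ?a g n)"
    by (intro summable_add fock_spaceD(2) assms)
  fix n :: nat assume "n \<ge> 0"
  have "norm (taylor_coeff f n) * norm (taylor_coeff g n)
      \<le> (norm (taylor_coeff f n))\<^sup>2 + (norm (taylor_coeff g n))\<^sup>2"
    using sum_squares_bound[of "norm (taylor_coeff f n)" "norm (taylor_coeff g n)"]
      mult_nonneg_nonneg[OF norm_ge_zero norm_ge_zero, of "taylor_coeff f n" "taylor_coeff g n"]
    by linarith
  then have "norm (taylor_coeff f n) * norm (taylor_coeff g n) * fact n ^ m
      \<le> ((norm (taylor_coeff f n))\<^sup>2 + (norm (taylor_coeff g n))\<^sup>2) * fact n ^ m"
    by (rule mult_right_mono) simp
  then show "norm (taylor_coeff f n * cnj (taylor_coeff g n) * fact n ^ m) \<le> ?a f n + ?a g n"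
    by (simp add: norm_mult norm_power algebra_simps)
qed

section \<open>The common domain of the two operators\<close>

lemma fock_domain_alt:
  assumes "m \<ge> 1"
  shows "fock_domain m = {f. f holomorphic_on UNIV \<and>
    summable (\<lambda>n. (norm (taylor_coeff f (Suc n)))\<^sup>2 * fact (Suc n) ^ m * real (Suc n) ^ m)}"
  unfolding fock_domain_def by (subst summable_Suc_iff[symmetric]) simp

lemma fock_domain_subset:
  assumes "m \<ge> 1"
  shows "fock_domain m \<subseteq> fock_space m"
proof
  fix f assume f: "f \<in> fock_domain m"
  have "summable (\<lambda>n. (norm (taylor_coeff f (Suc n)))\<^sup>2 * fact (Suc n) ^ m)"
  proof (rule summable_comparison_test')
    show "summable (\<lambda>n. (norm (taylor_coeff f (Suc n)))\<^sup>2 * fact (Suc n) ^ m * real (Suc n) ^ m)"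
      using f fock_domain_alt[OF assms] by simp
    fix n :: nat assume "n \<ge> 0"
    have "(norm (taylor_coeff f (Suc n)))\<^sup>2 * fact (Suc n) ^ m * 1
      \<le> (norm (taylor_coeff f (Suc n)))\<^sup>2 * fact (Suc n) ^ m * real (Suc n) ^ m"
      by (intro mult_left_mono one_le_power) (auto simp del: fact_Suc)
    then show "norm ((norm (taylor_coeff f (Suc n)))\<^sup>2 * fact (Suc n) ^ m)
      \<le> (norm (taylor_coeff f (Suc n)))\<^sup>2 * fact (Suc n) ^ m * real (Suc n) ^ m"
      by (simp del: fact_Suc)
  qed
  then have "summable (\<lambda>n. (norm (taylor_coeff f n))\<^sup>2 * fact n ^ m)"
    by (subst summable_Suc_iff[symmetric])
  then show "f \<in> fock_space m"
    using f by (simp add: fock_space_def fock_domain_def)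
qed

lemma mult_z_in_fock_space_iff:
  assumes "f \<in> fock_space m"
  shows "mult_z f \<in> fock_space m \<longleftrightarrow>
    summable (\<lambda>n. (norm (taylor_coeff f n))\<^sup>2 * fact (Suc n) ^ m)"
proof -
  note f = fock_spaceD(1)[OF assms]
  have "mult_z f \<in> fock_space m \<longleftrightarrow>
      summable (\<lambda>n. (norm (taylor_coeff (mult_z f) (Suc n)))\<^sup>2 * fact (Suc n) ^ m)"
    unfolding fock_space_def by (subst summable_Suc_iff) (simp add: mult_z_entire f)
  then show ?thesis by (simp only: taylor_coeff_mult_z(2)[OF f])
qed

lemma Domain_max_operator: "Domain (max_operator F T) = {f \<in> F. T f \<in> F}"
  by (auto simp: max_operator_def)

text \<open>The norm of z f carries the weights (n+1)!^m = n!^m (n+1)^m. Membership in D uses n^m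
  instead of (n+1)^m, and these are comparable for n at least 1.\<close>

lemma Domain_mult_z:
  assumes "m \<ge> 1"
  shows "Domain (max_operator (fock_space m) mult_z) = fock_domain m"
proof (intro equalityI subsetI)
  let ?a = "\<lambda>f n. (norm (taylor_coeff f n))\<^sup>2"
  have eq: "?a f n * fact (Suc n) ^ m = ?a f n * fact n ^ m * real (Suc n) ^ m" for f n
    by (simp add: power_mult_distrib mult_ac del: of_nat_Suc)
  {
    fix f assume "f \<in> Domain (max_operator (fock_space m) mult_z)"
    then have f: "f \<in> fock_space m" "mult_z f \<in> fock_space m"
      by (auto simp: Domain_max_operator)
    then have "summable (\<lambda>n. ?a f n * fact n ^ m * real (Suc n) ^ m)"
      unfolding mult_z_in_fock_space_iff[OF f(1)] eq by blast
    then have "summable (\<lambda>n. ?a f n * fact n ^ m * real n ^ m)"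
      by (rule summable_comparison_test'[where N = 0])
         (auto intro!: mult_left_mono power_mono)
    then show "f \<in> fock_domain m"
      using fock_spaceD(1)[OF f(1)] by (simp add: fock_domain_def)
  }
  fix f assume fD: "f \<in> fock_domain m"
  then have f: "f \<in> fock_space m" using fock_domain_subset[OF assms] by blast
  have "summable (\<lambda>n. ?a f n * fact n ^ m * real n ^ m)"
    using fD by (simp add: fock_domain_def)
  \<comment> \<open>The constant comes from n + 1 \<le> 2 n, valid for n at least 1. The comparison
    therefore starts at index 1; at 0 the majorant vanishes.\<close>
  from summable_mult[OF this, of "2 ^ m"]
  have "summable (\<lambda>n. 2 ^ m * (?a f n * fact n ^ m * real n ^ m))" .
  then have "summable (\<lambda>n. ?a f n * fact n ^ m * real (Suc n) ^ m)"
  proof (rule summable_comparison_test'[where N = 1])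
    fix n :: nat assume "n \<ge> 1"
    then have "real (Suc n) ^ m \<le> (2 * real n) ^ m"
      by (intro power_mono) auto
    then have "?a f n * fact n ^ m * real (Suc n) ^ m \<le> ?a f n * fact n ^ m * (2 * real n) ^ m"
      by (intro mult_left_mono) auto
    then show "norm (?a f n * fact n ^ m * real (Suc n) ^ m)
        \<le> 2 ^ m * (?a f n * fact n ^ m * real n ^ m)"
      by (simp add: power_mult_distrib algebra_simps)
  qed
  then have "mult_z f \<in> fock_space m"
    unfolding mult_z_in_fock_space_iff[OF f] eq .
  then show "f \<in> Domain (max_operator (fock_space m) mult_z)"
    using f by (simp add: Domain_max_operator)
qed

text \<open>Squaring the factor (n+1)^m gives (n+1)^(2m) n!^m = (n+1)!^m (n+1)^m. This is exactly
  the weight of D at index n + 1, so no estimate is required.\<close>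

lemma Domain_ba_power_b:
  assumes "m \<ge> 1"
  shows "Domain (max_operator (fock_space m) (ba_power_b m)) = fock_domain m"
proof -
  have "ba_power_b m f \<in> fock_space m \<longleftrightarrow> f \<in> fock_domain m" if f: "f holomorphic_on UNIV" for f
  proof -
    have "(norm (taylor_coeff (ba_power_b m f) n))\<^sup>2 * fact n ^ m
        = (norm (taylor_coeff f (Suc n)))\<^sup>2 * fact (Suc n) ^ m * real (Suc n) ^ m" for n
    proof -
      have "(norm (taylor_coeff (ba_power_b m f) n))\<^sup>2 * fact n ^ m
        = (real (Suc n) ^ m)\<^sup>2 * (norm (taylor_coeff f (Suc n)))\<^sup>2 * fact n ^ m"
        by (simp add: taylor_coeff_ba_power_b[OF f assms] norm_mult norm_power power_mult_distrib
            del: of_nat_Suc)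
      also have "\<dots> = (norm (taylor_coeff f (Suc n)))\<^sup>2 * fact (Suc n) ^ m * real (Suc n) ^ m"
        by (simp add: power_mult_distrib power2_eq_square del: of_nat_Suc)
      finally show ?thesis .
    qed
    then show ?thesis
      using f by (simp add: fock_space_def fock_domain_alt[OF assms] ba_power_b_entire)
  qed
  then show ?thesis
    using fock_domain_subset[OF assms] fock_spaceD(1) by (auto simp: Domain_max_operator)
qed

section \<open>Density, closedness and the adjoint\<close>

lemma power_sum_in_fock_domain: "power_sum b N \<in> fock_domain m"
proof -
  have "summable (\<lambda>n. (norm (taylor_coeff (power_sum b N) n))\<^sup>2 * fact n ^ m * real n ^ m)"
    by (rule summable_finite[of "{..<N}"]) (auto simp: taylor_coeff_power_sum)
  then show ?thesis by (simp add: fock_domain_def power_sum_entire)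
qed

text \<open>Taylor partial sums lie in D, and the squared norm of the error is a tail of the
  convergent norm series.\<close>

lemma dense_in_fock_domain:
  assumes "m \<ge> 1"
  shows "dense_in (fock_space m) (fock_ip m) (fock_domain m)"
  unfolding dense_in_def
proof (intro conjI ballI allI impI)
  show "fock_domain m \<subseteq> fock_space m" by (rule fock_domain_subset[OF assms])
  fix f and e :: real assume f: "f \<in> fock_space m" and e: "e > 0"
  let ?t = "\<lambda>n. (norm (taylor_coeff f n))\<^sup>2 * fact n ^ m :: real"
  have s: "summable ?t" by (rule fock_spaceD[OF f])
  obtain N where N: "norm (\<Sum>i. ?t (i + N)) < e\<^sup>2"
    using suminf_exist_split[of "e\<^sup>2", OF _ s] e by auto
  let ?p = "power_sum (taylor_coeff f) N"
  have p: "?p \<in> fock_space m"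
    using power_sum_in_fock_domain fock_domain_subset[OF assms] by blast
  have d: "(\<lambda>z. f z - ?p z) \<in> fock_space m" by (rule fock_space_diff[OF f p])
  let ?u = "\<lambda>n. (norm (taylor_coeff (\<lambda>z. f z - ?p z) n))\<^sup>2 * fact n ^ m :: real"
  have u: "?u n = (if n < N then 0 else ?t n)" for n
    by (simp add: taylor_coeff_diff fock_spaceD(1)[OF f] power_sum_entire taylor_coeff_power_sum)
  have "suminf ?u = (\<Sum>n. ?u (n + N)) + (\<Sum>n<N. ?u n)"
    by (rule suminf_split_initial_segment[OF fock_spaceD(2)[OF d]])
  also have "\<dots> = (\<Sum>n. ?t (n + N))" by (simp add: u)
  finally have "(hnorm (fock_ip m) (\<lambda>z. f z - ?p z))\<^sup>2 < e\<^sup>2"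
    using N by (simp add: fock_hnorm_sq[OF d])
  then have "hnorm (fock_ip m) (\<lambda>z. f z - ?p z) < e"
    using e by (meson less_eq_real_def power_less_imp_less_base)
  then show "\<exists>g\<in>fock_domain m. hnorm (fock_ip m) (\<lambda>z. f z - g z) < e"
    using power_sum_in_fock_domain by blast
qed

text \<open>Norm convergence implies convergence of every Taylor coefficient, so the graph of a maximal
  operator is closed as soon as the coefficients of \<open>T f\<close> depend continuously on those of \<open>f\<close>.\<close>

lemma closed_max_operator_fock:
  assumes entire: "\<And>f. f holomorphic_on UNIV \<Longrightarrow> T f holomorphic_on UNIV"
    and coeff: "\<And>f n. f holomorphic_on UNIV \<Longrightarrow> taylor_coeff (T f) n = c n * taylor_coeff f (s n)"
  shows "closed_operator (fock_space m) (fock_ip m) (max_operator (fock_space m) T)"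
  unfolding closed_operator_def
proof (intro allI impI, elim conjE)
  fix F G f g
  assume FG: "\<forall>n::nat. (F n, G n) \<in> max_operator (fock_space m) T"
    and f: "f \<in> fock_space m" and g: "g \<in> fock_space m"
    and Ff: "(\<lambda>n. hnorm (fock_ip m) (\<lambda>z. F n z - f z)) \<longlonglongrightarrow> 0"
    and Gg: "(\<lambda>n. hnorm (fock_ip m) (\<lambda>z. G n z - g z)) \<longlonglongrightarrow> 0"
  have F: "F n \<in> fock_space m" and G: "G n \<in> fock_space m" "G n = T (F n)" for n
    using FG by (auto simp: max_operator_def)
  have "g = T f"
  proof (rule entire_eqI)
    fix n
    have "(\<lambda>j. taylor_coeff (G j) n) \<longlonglongrightarrow> taylor_coeff g n"
      by (rule fock_convergence_imp_coeff[OF G(1) g Gg])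
    moreover have "(\<lambda>j. taylor_coeff (G j) n) \<longlonglongrightarrow> c n * taylor_coeff f (s n)"
      unfolding G(2) coeff[OF fock_spaceD(1)[OF F]]
      by (intro tendsto_mult tendsto_const fock_convergence_imp_coeff[OF F f Ff])
    ultimately show "taylor_coeff g n = taylor_coeff (T f) n"
      using LIMSEQ_unique coeff[OF fock_spaceD(1)[OF f]] by metis
  qed (use f g entire fock_spaceD(1) in auto)
  then show "(f, g) \<in> max_operator (fock_space m) T"
    using f g by (auto simp: max_operator_def)
qed

text \<open>Testing the adjoint relation on monomials determines every coefficient of h, which gives
  one inclusion. The other is an index shift in the inner product series, absorbing (n+1)^m into
  (n+1)!^m = n!^m (n+1)^m.\<close>

lemma adjoint_mult_z_fock:
  assumes m: "m \<ge> 1"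
  shows "adjoint_operator (fock_space m) (fock_ip m) (max_operator (fock_space m) mult_z)
    = max_operator (fock_space m) (ba_power_b m)"
proof (intro equalityI subrelI)
  fix g h
  assume "(g, h) \<in> adjoint_operator (fock_space m) (fock_ip m) (max_operator (fock_space m) mult_z)"
  then have g: "g \<in> fock_space m" and h: "h \<in> fock_space m"
    and adj: "\<And>f. f \<in> fock_domain m \<Longrightarrow> fock_ip m (mult_z f) g = fock_ip m f h"
    unfolding Domain_mult_z[OF m, symmetric] by (auto simp: adjoint_operator_def max_operator_def)
  have "h = ba_power_b m g"
  proof (rule entire_eqI)
    fix n
    have ip: "fock_ip m (\<lambda>z. z ^ k) u = cnj (taylor_coeff u k) * fact k ^ m" for k u
    proof -
      have "fock_ip m (\<lambda>z. z ^ k) u =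
          (\<Sum>n\<in>{k}. taylor_coeff (\<lambda>z. z ^ k) n * cnj (taylor_coeff u n) * fact n ^ m)"
        unfolding fock_ip_def by (intro suminf_finite) (auto simp: taylor_coeff_power)
      then show ?thesis by (simp add: taylor_coeff_power)
    qed
    \<comment> \<open>Pairing with a monomial isolates one conjugated coefficient, so this test
      function expresses coefficient n of h through coefficient n + 1 of g.\<close>
    have "(\<lambda>z. z ^ n) \<in> fock_domain m"
      unfolding power_eq_power_sum by (rule power_sum_in_fock_domain)
    from adj[OF this] have "fock_ip m (\<lambda>z. z ^ Suc n) g = fock_ip m (\<lambda>z. z ^ n) h"
      by (simp add: mult_z_def)
    then have "cnj (taylor_coeff g (Suc n)) * fact (Suc n) ^ m = cnj (taylor_coeff h n) * fact n ^ m"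
      unfolding ip .
    then have "cnj (taylor_coeff g (Suc n)) * of_nat (Suc n) ^ m = cnj (taylor_coeff h n)"
      by (simp add: power_mult_distrib del: of_nat_Suc)
    then have "cnj (cnj (taylor_coeff g (Suc n)) * of_nat (Suc n) ^ m) = taylor_coeff h n"
      by (metis complex_cnj_cnj)
    then show "taylor_coeff h n = taylor_coeff (ba_power_b m g) n"
      by (simp add: taylor_coeff_ba_power_b[OF fock_spaceD(1)[OF g] m] mult.commute del: of_nat_Suc)
  qed (use g h ba_power_b_entire fock_spaceD(1) in auto)
  then show "(g, h) \<in> max_operator (fock_space m) (ba_power_b m)"
    using g h by (auto simp: max_operator_def)
next
  fix g h
  assume "(g, h) \<in> max_operator (fock_space m) (ba_power_b m)"
  then have g: "g \<in> fock_space m" and h: "h \<in> fock_space m" and hg: "h = ba_power_b m g"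
    by (auto simp: max_operator_def)
  have "fock_ip m (mult_z f) g = fock_ip m f h"
    if f: "f \<in> fock_space m" and zf: "mult_z f \<in> fock_space m" for f
  proof -
    let ?s = "\<lambda>n. taylor_coeff (mult_z f) n * cnj (taylor_coeff g n) * fact n ^ m"
    have "fock_ip m (mult_z f) g = (\<Sum>n. ?s (Suc n)) + ?s 0"
      using suminf_split_head[OF summable_fock_ip[OF zf g]] by (simp add: fock_ip_def)
    \<comment> \<open>Since z f vanishes at the origin, the series effectively begins at index
      1.\<close>
    also have "?s 0 = 0" by (simp add: taylor_coeff_mult_z fock_spaceD(1)[OF f])
    also have "(\<Sum>n. ?s (Suc n)) = fock_ip m f h"
      unfolding fock_ip_def hg
      by (intro suminf_cong) (simp add: taylor_coeff_mult_z fock_spaceD(1)[OF f] power_mult_distrib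
          taylor_coeff_ba_power_b[OF fock_spaceD(1)[OF g] m] del: of_nat_Suc)
    finally show ?thesis by simp
  qed
  then show "(g, h) \<in> adjoint_operator (fock_space m) (fock_ip m) (max_operator (fock_space m) mult_z)"
    using g h by (auto simp: adjoint_operator_def max_operator_def)
qed

section \<open>Hilbert spaces of entire functions with orthogonal monomials\<close>

context entire_hilbert_space
begin

section \<open>Inner product identities, Cauchy-Schwarz and pointwise limits\<close>

lemma diff_mem:
  assumes "f \<in> H" "g \<in> H"
  shows "(\<lambda>z. f z - g z) \<in> H"
  using add_mem[OF assms(1) scale_mem[OF assms(2), of "-1"]] by simp

lemma ip_diff_left:
  assumes "f \<in> H" "g \<in> H" "h \<in> H"
  shows "ip (\<lambda>z. f z - g z) h = ip f h - ip g h"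
  using ip_add_left[OF assms(1) scale_mem[OF assms(2), of "-1"] assms(3)]
    ip_scale_left[OF assms(2,3), of "-1"] by simp

lemma ip_add_right:
  assumes "f \<in> H" "g \<in> H" "h \<in> H"
  shows "ip h (\<lambda>z. f z + g z) = ip h f + ip h g"
  using ip_add_left[OF assms] ip_commute[OF assms(3) add_mem[OF assms(1,2)]]
    ip_commute[OF assms(3,1)] ip_commute[OF assms(3,2)]
  by (metis complex_cnj_add complex_cnj_cnj)

lemma ip_scale_right:
  assumes "f \<in> H" "g \<in> H"
  shows "ip g (\<lambda>z. c * f z) = cnj c * ip g f"
  using ip_scale_left[OF assms, of c] ip_commute[OF assms(2) scale_mem[OF assms(1), of c]]
    ip_commute[OF assms(2,1)]
  by (metis complex_cnj_mult complex_cnj_cnj)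

lemma ip_zero_left: "g \<in> H \<Longrightarrow> ip (\<lambda>z. 0) g = 0"
  using ip_scale_left[OF zero_mem, of g 0] by simp

lemma ip_self_nonneg: "f \<in> H \<Longrightarrow> Re (ip f f) \<ge> 0"
  using ip_pos ip_zero_left[OF zero_mem] by (cases "f = (\<lambda>z. 0)") (auto simp: less_imp_le)

lemma ip_self_real:
  assumes "f \<in> H"
  shows "ip f f = of_real (Re (ip f f))"
  using ip_commute[OF assms assms] by (metis Reals_cnj_iff of_real_Re)

lemma hnorm_sq: "f \<in> H \<Longrightarrow> (hnorm ip f)\<^sup>2 = Re (ip f f)"
  by (simp add: hnorm_def ip_self_nonneg)

lemma ip_add_self:
  assumes "u \<in> H" "v \<in> H"
  shows "Re (ip (\<lambda>z. u z + v z) (\<lambda>z. u z + v z)) = Re (ip u u) + Re (ip v v) + 2 * Re (ip u v)"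
  using assms ip_commute[OF assms] by (simp add: ip_add_left ip_add_right add_mem)

lemma cauchy_schwarz:
  assumes "u \<in> H" "v \<in> H"
  shows "norm (ip u v) \<le> hnorm ip u * hnorm ip v"
proof (cases "v = (\<lambda>z. 0)")
  case True
  then show ?thesis
    using ip_commute[OF assms(2,1)] ip_zero_left[OF assms(1)] ip_zero_left[OF zero_mem]
    by (simp add: hnorm_def)
next
  case False
  let ?r = "Re (ip v v)"
  have r: "?r > 0" using ip_pos assms False by blast
  \<comment> \<open>This scalar minimises the norm of u + c v; nonnegativity of the minimum is the
    desired inequality.\<close>
  define c where "c = - ip u v / of_real ?r"
  have cm: "(\<lambda>z. c * v z) \<in> H" by (rule scale_mem[OF assms(2)])
  have "0 \<le> Re (ip u u) + Re (c * (cnj c * ip v v)) + 2 * Re (cnj c * ip u v)"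
    using ip_self_nonneg[OF add_mem[OF assms(1) cm]] ip_add_self[OF assms(1) cm]
    by (simp add: ip_scale_left[OF assms(2) cm] ip_scale_right[OF assms(2) assms(2)]
        ip_scale_right[OF assms(2) assms(1)])
  also have "c * (cnj c * ip v v) = ip u v * cnj (ip u v) / of_real ?r"
    using r by (subst ip_self_real[OF assms(2)]) (simp add: c_def field_simps)
  also have "\<dots> = of_real ((norm (ip u v))\<^sup>2 / ?r)"
    by (simp only: complex_norm_square of_real_divide)
  also have "cnj c * ip u v = - (ip u v * cnj (ip u v) / of_real ?r)"
    by (simp add: c_def)
  also have "\<dots> = of_real (- (norm (ip u v))\<^sup>2 / ?r)"
    by (simp only: complex_norm_square of_real_divide of_real_minus minus_divide_left)
  finally have "(norm (ip u v))\<^sup>2 / ?r \<le> Re (ip u u)" by simp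
  then have "(norm (ip u v))\<^sup>2 \<le> Re (ip u u) * ?r" using r by (simp add: field_simps)
  then have "(norm (ip u v))\<^sup>2 \<le> (hnorm ip u * hnorm ip v)\<^sup>2"
    by (simp add: power_mult_distrib hnorm_sq assms)
  then show ?thesis
    by (rule power2_le_imp_le) (simp add: hnorm_def ip_self_nonneg assms)
qed

text \<open>Bounded point evaluations tie the abstract norm to function values. This lets a norm
  limit be recognised as a concrete entire function.\<close>

lemma tendsto_pointwise:
  assumes "\<And>N. s N \<in> H" "f \<in> H" "(\<lambda>N. hnorm ip (\<lambda>z. s N z - f z)) \<longlonglongrightarrow> 0"
  shows "(\<lambda>N. s N w) \<longlonglongrightarrow> f w"
proof -
  obtain C where C: "\<And>f. f \<in> H \<Longrightarrow> norm (f w) \<le> C * hnorm ip f"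
    using bounded_evaluation[of w] by blast
  show ?thesis
  proof (rule LIM_zero_cancel, rule Lim_null_comparison[OF always_eventually], rule allI)
    show "norm (s N w - f w) \<le> C * hnorm ip (\<lambda>z. s N z - f z)" for N
      using C[OF diff_mem[OF assms(1,2), of N]] .
    show "(\<lambda>N. C * hnorm ip (\<lambda>z. s N z - f z)) \<longlonglongrightarrow> 0"
      using tendsto_mult[OF tendsto_const assms(3)] by simp
  qed
qed

end

text \<open>This isolates the part of the converse that mentions neither m nor the adjoint. The
  weights are kept general; their positivity follows from that of \<open>ip\<close>, and
  \<open>dense_in\<close> already places the polynomials in \<open>H\<close>.\<close>

locale orthogonal_monomials = entire_hilbert_space H ip
  for H :: "(complex \<Rightarrow> complex) set" and ip +
  fixes weight :: "nat \<Rightarrow> real"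
  assumes dense: "dense_in H ip polynomial_functions"
    and ip_monomials: "ip (\<lambda>z. z ^ n) (\<lambda>z. z ^ k) = (if n = k then of_real (weight n) else 0)"
begin

section \<open>Orthogonal expansions in monomials\<close>

lemma power_sum_mem: "power_sum b N \<in> H"
proof (induction N)
  case 0
  then show ?case using zero_mem by (simp add: power_sum_def)
next
  case (Suc N)
  have "poly (monom 1 N) \<in> H"
    using dense by (auto simp: dense_in_def polynomial_functions_def)
  moreover have "poly (monom 1 N) = (\<lambda>z::complex. z ^ N)" by (simp add: fun_eq_iff poly_monom)
  ultimately have "(\<lambda>z. z ^ N) \<in> H" by simp
  from add_mem[OF Suc scale_mem[OF this, of "b N"]]
  show ?case by (simp add: power_sum_def)
qed

lemma monomial_mem: "(\<lambda>z. z ^ n) \<in> H"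
  unfolding power_eq_power_sum by (rule power_sum_mem)

lemma weight_pos: "weight n > 0"
proof -
  have "(\<lambda>z::complex. z ^ n) 1 \<noteq> (\<lambda>z. 0) (1::complex)" by simp
  then have "(\<lambda>z::complex. z ^ n) \<noteq> (\<lambda>z. 0)" by metis
  then show ?thesis using ip_pos[OF monomial_mem, of n] by (simp add: ip_monomials)
qed

lemma ip_power_sum_left:
  assumes "g \<in> H"
  shows "ip (power_sum b N) g = (\<Sum>n<N. b n * ip (\<lambda>z. z ^ n) g)"
proof (induction N)
  case 0
  then show ?case using ip_zero_left[OF assms] by (simp add: power_sum_def)
next
  case (Suc N)
  have "power_sum b (Suc N) = (\<lambda>z. power_sum b N z + b N * z ^ N)"
    by (simp add: power_sum_def)
  then show ?case
    using Suc ip_add_left[OF power_sum_mem[of b N] scale_mem[OF monomial_mem[of N], of "b N"] assms]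
      ip_scale_left[OF monomial_mem[of N] assms, of "b N"] by simp
qed

lemma ip_power_sum_monomial:
  "ip (power_sum b N) (\<lambda>z. z ^ k) = (if k < N then b k * of_real (weight k) else 0)"
  by (simp add: ip_power_sum_left[OF monomial_mem] ip_monomials if_distrib[of "\<lambda>x. _ * x"] cong: if_cong)

lemma ip_monomial_power_sum:
  "ip (\<lambda>z. z ^ k) (power_sum b N) = (if k < N then cnj (b k) * of_real (weight k) else 0)"
  using ip_commute[OF power_sum_mem[of b N] monomial_mem[of k]] by (simp add: ip_power_sum_monomial)

lemma ip_power_sum_self:
  "Re (ip (power_sum b N) (power_sum b N)) = (\<Sum>n<N. (norm (b n))\<^sup>2 * weight n)"
proof -
  have "ip (power_sum b N) (power_sum b N) = (\<Sum>n<N. of_real ((norm (b n))\<^sup>2 * weight n))"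
    unfolding ip_power_sum_left[OF power_sum_mem]
    by (intro sum.cong refl) (simp add: ip_monomial_power_sum mult_cnj_of_real mult.assoc[symmetric] del: of_real_mult of_real_power)
  then show ?thesis by (simp flip: of_real_sum)
qed

text \<open>The monomials are orthogonal but not normalised; dividing by the weight makes the
  partial sums orthogonal projections onto polynomials of degree below N.\<close>

definition fourier :: "(complex \<Rightarrow> complex) \<Rightarrow> nat \<Rightarrow> complex"
  where "fourier f n = ip f (\<lambda>z. z ^ n) / of_real (weight n)"

lemma residual_orthogonal:
  assumes "f \<in> H"
  shows "ip (\<lambda>z. f z - power_sum (fourier f) N z) (power_sum d N) = 0"
proof -
  let ?u = "\<lambda>z. f z - power_sum (fourier f) N z"
  have u: "?u \<in> H" by (rule diff_mem[OF assms power_sum_mem])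
  have "ip ?u (\<lambda>z. z ^ k) = 0" if "k < N" for k
    using that weight_pos[of k]
    by (simp add: ip_diff_left[OF assms power_sum_mem monomial_mem] ip_power_sum_monomial fourier_def)
  then have "ip (\<lambda>z. z ^ k) ?u = 0" if "k < N" for k
    using that ip_commute[OF u monomial_mem] by simp
  then have "ip (power_sum d N) ?u = 0"
    by (simp add: ip_power_sum_left[OF u])
  then show ?thesis using ip_commute[OF power_sum_mem u] by simp
qed

text \<open>Pythagoras: the error splits into the residual of the projection and a polynomial of
  degree below N, which are orthogonal. Hence the projection is the best approximation of that
  degree.\<close>

lemma hnorm_fourier_approx:
  assumes "f \<in> H"
  shows "Re (ip (\<lambda>z. f z - power_sum d N z) (\<lambda>z. f z - power_sum d N z)) =
    (hnorm ip (\<lambda>z. f z - power_sum (fourier f) N z))\<^sup>2 + (\<Sum>n<N. (norm (fourier f n - d n))\<^sup>2 * weight n)"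
proof -
  let ?u = "\<lambda>z. f z - power_sum (fourier f) N z"
  let ?q = "power_sum (\<lambda>n. fourier f n - d n) N"
  have u: "?u \<in> H" by (rule diff_mem[OF assms power_sum_mem])
  have "(\<lambda>z. f z - power_sum d N z) = (\<lambda>z. ?u z + ?q z)"
    by (simp add: power_sum_def algebra_simps sum_subtractf)
  then show ?thesis
    using ip_add_self[OF u power_sum_mem] residual_orthogonal[OF assms]
    by (simp add: ip_power_sum_self hnorm_sq[OF u])
qed

text \<open>Density provides one polynomial close to f. By best approximation, every projection of
  sufficiently high degree is at least as close.\<close>

lemma fourier_converges:
  assumes f: "f \<in> H"
  shows "(\<lambda>N. hnorm ip (\<lambda>z. f z - power_sum (fourier f) N z)) \<longlonglongrightarrow> 0"
proof (rule LIMSEQ_I)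
  fix e :: real assume e: "e > 0"
  obtain p where p: "hnorm ip (\<lambda>z. f z - poly p z) < e"
    using dense f e unfolding dense_in_def polynomial_functions_def by blast
  have "norm (hnorm ip (\<lambda>z. f z - power_sum (fourier f) N z) - 0) < e" if N: "N \<ge> Suc (degree p)" for N
  proof -
    let ?u = "\<lambda>z. f z - power_sum (fourier f) N z"
    have u: "?u \<in> H" by (rule diff_mem[OF f power_sum_mem])
    \<comment> \<open>Padding with zero coefficients makes p a competitor at every level N beyond
      its degree.\<close>
    have pN: "poly p = power_sum (coeff p) N"
      unfolding poly_eq_power_sum power_sum_def
      by (intro ext sum.mono_neutral_left) (use N in \<open>auto simp: coeff_eq_0\<close>)
    have "(hnorm ip ?u)\<^sup>2 \<le> (hnorm ip (\<lambda>z. f z - poly p z))\<^sup>2"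
      unfolding pN hnorm_sq[OF diff_mem[OF f power_sum_mem]]
      unfolding hnorm_fourier_approx[OF f] hnorm_sq[OF u, symmetric]
      using weight_pos by (simp add: sum_nonneg less_imp_le)
    then have "hnorm ip ?u \<le> hnorm ip (\<lambda>z. f z - poly p z)"
      by (rule power2_le_imp_le) (simp add: hnorm_def pN ip_self_nonneg diff_mem f power_sum_mem)
    with p have "hnorm ip ?u < e" by simp
    moreover have "hnorm ip ?u \<ge> 0" by (simp add: hnorm_def ip_self_nonneg u)
    ultimately show ?thesis by simp
  qed
  then show "\<exists>no. \<forall>N\<ge>no. norm (hnorm ip (\<lambda>z. f z - power_sum (fourier f) N z) - 0) < e"
    by blast
qed

lemma hnorm_minus_commute:
  assumes "f \<in> H" "g \<in> H"
  shows "hnorm ip (\<lambda>z. f z - g z) = hnorm ip (\<lambda>z. g z - f z)"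
proof -
  note d = diff_mem[OF assms]
  have "(\<lambda>z. g z - f z) = (\<lambda>z. - 1 * (f z - g z))" by simp
  then have "ip (\<lambda>z. g z - f z) (\<lambda>z. g z - f z) = ip (\<lambda>z. f z - g z) (\<lambda>z. f z - g z)"
    using ip_scale_left[OF d scale_mem[OF d, of "-1"], of "-1"] ip_scale_right[OF d d, of "-1"] by simp
  then show ?thesis by (simp add: hnorm_def)
qed

text \<open>The Fourier sums converge in norm, hence pointwise. Being partial sums of a power
  series, they can only be the Taylor expansion.\<close>

lemma fourier_eq_taylor_coeff:
  assumes f: "f \<in> H"
  shows "fourier f = taylor_coeff f"
proof
  have "(\<lambda>N. hnorm ip (\<lambda>z. power_sum (fourier f) N z - f z)) \<longlonglongrightarrow> 0"
    using fourier_converges[OF f] by (simp add: hnorm_minus_commute[OF f power_sum_mem])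
  from tendsto_pointwise[OF power_sum_mem f this]
  have "(\<lambda>n. fourier f n * w ^ n) sums f w" for w
    by (simp add: sums_def power_sum_def)
  then show "fourier f n = taylor_coeff f n" for n
    using taylor_coeff_unique by metis
qed

lemma ip_monomial_left:
  assumes "g \<in> H"
  shows "ip (\<lambda>z. z ^ n) g = cnj (taylor_coeff g n) * of_real (weight n)"
proof -
  have "ip g (\<lambda>z. z ^ n) = taylor_coeff g n * of_real (weight n)"
    using weight_pos[of n] by (simp add: fourier_eq_taylor_coeff[OF assms, symmetric] fourier_def)
  then show ?thesis using ip_commute[OF assms monomial_mem, of n] by simp
qed

text \<open>Parseval's identity: Cauchy-Schwarz carries the norm convergence of the expansion of f
  through the inner product with g.\<close>

lemma ip_sums:
  assumes f: "f \<in> H" and g: "g \<in> H"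
  shows "(\<lambda>n. taylor_coeff f n * cnj (taylor_coeff g n) * of_real (weight n)) sums ip f g"
proof -
  let ?s = "power_sum (fourier f)"
  have "(\<lambda>N. ip f g - ip (?s N) g) \<longlonglongrightarrow> 0"
  proof (rule Lim_null_comparison[OF always_eventually], rule allI)
    show "norm (ip f g - ip (?s N) g) \<le> hnorm ip (\<lambda>z. f z - ?s N z) * hnorm ip g" for N
      using cauchy_schwarz[OF diff_mem[OF f power_sum_mem] g]
      by (simp add: ip_diff_left[OF f power_sum_mem g])
    show "(\<lambda>N. hnorm ip (\<lambda>z. f z - ?s N z) * hnorm ip g) \<longlonglongrightarrow> 0"
      using tendsto_mult[OF fourier_converges[OF f] tendsto_const] by simp
  qed
  from tendsto_diff[OF tendsto_const[of "ip f g"] this]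
  have "(\<lambda>N. ip (?s N) g) \<longlonglongrightarrow> ip f g" by simp
  then show ?thesis
    unfolding ip_power_sum_left[OF g] ip_monomial_left[OF g] fourier_eq_taylor_coeff[OF f]
    by (simp add: sums_def mult.assoc)
qed

text \<open>Forwards this is Parseval with g = f. Backwards, summability makes the Taylor partial
  sums Cauchy, completeness yields a limit in \<open>H\<close>, and pointwise convergence identifies
  it with f.\<close>

lemma mem_iff:
  "f \<in> H \<longleftrightarrow> f holomorphic_on UNIV \<and> summable (\<lambda>n. (norm (taylor_coeff f n))\<^sup>2 * weight n)"
proof (intro iffI conjI; (elim conjE)?)
  assume f: "f \<in> H"
  then show "f holomorphic_on UNIV" by (rule entire)
  have "taylor_coeff f n * cnj (taylor_coeff f n) * of_real (weight n)
      = of_real ((norm (taylor_coeff f n))\<^sup>2 * weight n)" for n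
    by (rule mult_cnj_of_real)
  then show "summable (\<lambda>n. (norm (taylor_coeff f n))\<^sup>2 * weight n)"
    using sums_summable[OF ip_sums[OF f f]] by (simp only: summable_complex_of_real)
next
  assume f: "f holomorphic_on UNIV"
  let ?t = "\<lambda>n. (norm (taylor_coeff f n))\<^sup>2 * weight n"
  assume s: "summable ?t"
  let ?s = "power_sum (taylor_coeff f)"
  have close: "hnorm ip (\<lambda>z. ?s j z - ?s k z) < e"
    if N: "\<And>a b. a \<ge> N \<Longrightarrow> norm (sum ?t {a..<b}) < e\<^sup>2" and jk: "N \<le> j" "j \<le> k" and e: "e > 0"
    for N j k e
  proof -
    \<comment> \<open>Zeroing the first j coefficients turns the difference of two partial sums into
      a single \<open>power_sum\<close>, whose norm is known.\<close>
    let ?b = "\<lambda>n. if n < j then 0 else taylor_coeff f n"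
    have "hnorm ip (\<lambda>z. ?s j z - ?s k z) = hnorm ip (\<lambda>z. ?s k z - ?s j z)"
      by (rule hnorm_minus_commute[OF power_sum_mem power_sum_mem])
    also have "(\<lambda>z. ?s k z - ?s j z) = power_sum ?b k"
    proof
      fix z
      have "?s k z = ?s j z + (\<Sum>n=j..<k. taylor_coeff f n * z ^ n)"
        unfolding power_sum_def lessThan_atLeast0
        using jk by (simp add: sum.atLeastLessThan_concat)
      also have "(\<Sum>n=j..<k. taylor_coeff f n * z ^ n) = power_sum ?b k z"
        unfolding power_sum_def by (rule sum.mono_neutral_cong_left) auto
      finally show "?s k z - ?s j z = power_sum ?b k z" by simp
    qed
    also have "(hnorm ip (power_sum ?b k))\<^sup>2 = sum ?t {j..<k}"
      unfolding hnorm_sq[OF power_sum_mem] ip_power_sum_self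
      by (rule sum.mono_neutral_cong_right) auto
    then have "(hnorm ip (power_sum ?b k))\<^sup>2 < e\<^sup>2" using N[OF jk(1), of k] by simp
    then have "hnorm ip (power_sum ?b k) < e"
      using e by (meson less_eq_real_def power_less_imp_less_base)
    finally show ?thesis .
  qed
  have "\<exists>g\<in>H. (\<lambda>N. hnorm ip (\<lambda>z. ?s N z - g z)) \<longlonglongrightarrow> 0"
  proof (rule complete[OF power_sum_mem])
    fix e :: real assume e: "e > 0"
    then obtain N where N: "\<And>a b. a \<ge> N \<Longrightarrow> norm (sum ?t {a..<b}) < e\<^sup>2"
      using s unfolding summable_Cauchy by (meson zero_less_power)
    have "hnorm ip (\<lambda>z. ?s j z - ?s k z) < e" if "j \<ge> N" "k \<ge> N" for j k
    proof (cases "j \<le> k")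
      case True
      show ?thesis by (rule close[OF N that(1) True e])
    next
      case False
      then have "k \<le> j" by simp
      from close[OF N that(2) this e] show ?thesis
        by (simp only: hnorm_minus_commute[OF power_sum_mem power_sum_mem, of _ j])
    qed
    then show "\<exists>N. \<forall>j\<ge>N. \<forall>k\<ge>N. hnorm ip (\<lambda>z. ?s j z - ?s k z) < e" by blast
  qed
  then obtain g where g: "g \<in> H" "(\<lambda>N. hnorm ip (\<lambda>z. ?s N z - g z)) \<longlonglongrightarrow> 0" by blast
  have "f = g"
  proof
    fix w
    have "(\<lambda>N. ?s N w) \<longlonglongrightarrow> f w"
      using taylor_sums[OF f, of w] by (simp add: sums_def power_sum_def)
    then show "f w = g w"
      using tendsto_pointwise[OF power_sum_mem g] LIMSEQ_unique by blast
  qed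
  then show "f \<in> H" using g by simp
qed

end

text \<open>The adjoint relation applied to monomials reads
  \<open>\<langle>z\<^sup>n\<^sup>+\<^sup>1, z\<^sup>k\<^sup>+\<^sup>1\<rangle> = (k+1)\<^sup>m \<langle>z\<^sup>n, z\<^sup>k\<rangle>\<close> and \<open>\<langle>z\<^sup>n\<^sup>+\<^sup>1, 1\<rangle> = 0\<close>,
  which determines all inner products of monomials from \<open>\<langle>1, 1\<rangle>\<close>.\<close>

lemma adjoint_determines_monomials:
  assumes "entire_hilbert_space H ip" and dense: "dense_in H ip polynomial_functions"
    and adj: "adjoint_operator H ip (max_operator H mult_z) = max_operator H (ba_power_b m)"
    and m: "m \<ge> 1"
  shows "ip (\<lambda>z. z ^ n) (\<lambda>z. z ^ k) =
    (if n = k then of_real (Re (ip (\<lambda>z. 1) (\<lambda>z. 1)) * fact n ^ m) else 0)"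
proof -
  interpret entire_hilbert_space H ip by fact
  have mem: "(\<lambda>z. c * z ^ n) \<in> H" for c n
  proof -
    have "poly (monom c n) \<in> H"
      using dense by (auto simp: dense_in_def polynomial_functions_def)
    moreover have "poly (monom c n) = (\<lambda>z. c * z ^ n)" by (simp add: fun_eq_iff poly_monom)
    ultimately show ?thesis by simp
  qed
  have mono: "(\<lambda>z. z ^ n) \<in> H" for n using mem[of 1 n] by simp
  have entire_mono: "(\<lambda>z::complex. c * z ^ n) holomorphic_on UNIV" for c n
    by (intro holomorphic_intros)
  \<comment> \<open>Only one inclusion of the operator equality is used: g paired with its image
    lies in the adjoint graph, and is tested on a monomial.\<close>
  have adjD: "ip (\<lambda>z. z ^ Suc n) g = ip (\<lambda>z. z ^ n) (ba_power_b m g)"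
    if "g \<in> H" "ba_power_b m g \<in> H" for g n
  proof -
    have "(g, ba_power_b m g) \<in> adjoint_operator H ip (max_operator H mult_z)"
      unfolding adj using that by (auto simp: max_operator_def)
    moreover have "((\<lambda>z. z ^ n), (\<lambda>z. z ^ Suc n)) \<in> max_operator H mult_z"
      using mono[of n] mono[of "Suc n"] by (auto simp: max_operator_def mult_z_def)
    ultimately show ?thesis by (auto simp: adjoint_operator_def)
  qed
  \<comment> \<open>The constant 1 is annihilated, which makes it orthogonal to every higher
    monomial.\<close>
  have B0: "ba_power_b m (\<lambda>z. z ^ 0) = (\<lambda>z. 0)"
  proof (rule entire_eqI)
    fix n
    have "taylor_coeff (\<lambda>z. 0) n = 0" by (rule taylor_coeff_unique) simp
    then show "taylor_coeff (ba_power_b m (\<lambda>z. z ^ 0)) n = taylor_coeff (\<lambda>z. 0) n"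
      using taylor_coeff_ba_power_b[OF entire[OF mono] m, of 0 n] by (simp only: taylor_coeff_power) simp
  qed (rule ba_power_b_entire[OF entire[OF mono]] holomorphic_on_const)+
  have BS: "ba_power_b m (\<lambda>z. z ^ Suc k) = (\<lambda>z. of_nat (Suc k) ^ m * z ^ k)" for k
  proof (rule entire_eqI)
    fix n
    have "taylor_coeff (\<lambda>z. of_nat (Suc k) ^ m * z ^ k) n = of_nat (Suc k) ^ m * (if n = k then 1 else 0)"
    proof (rule taylor_coeff_unique)
      fix z :: complex
      have "(\<lambda>n. of_nat (Suc k) ^ m * (taylor_coeff (\<lambda>z. z ^ k) n * z ^ n)) sums (of_nat (Suc k) ^ m * z ^ k)"
        by (intro sums_mult taylor_sums holomorphic_intros)
      then show "(\<lambda>n. of_nat (Suc k) ^ m * (if n = k then 1 else 0) * z ^ n) sums (of_nat (Suc k) ^ m * z ^ k)"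
        by (simp only: taylor_coeff_power mult.assoc)
    qed
    then show "taylor_coeff (ba_power_b m (\<lambda>z. z ^ Suc k)) n
        = taylor_coeff (\<lambda>z. of_nat (Suc k) ^ m * z ^ k) n"
      using taylor_coeff_ba_power_b[OF entire[OF mono] m, of "Suc k" n]
      by (auto simp only: taylor_coeff_power) auto
  next
    show "(\<lambda>z. of_nat (Suc k) ^ m * z ^ k) holomorphic_on UNIV" by (rule entire_mono)
  qed (rule ba_power_b_entire[OF entire[OF mono]])
  have ip0: "ip (\<lambda>z. z ^ Suc n) (\<lambda>z. z ^ 0) = 0" for n
    using adjD[OF mono, of 0 n] ip_commute[OF zero_mem mono, of n] ip_zero_left[OF mono, of n]
    unfolding B0 by (simp add: zero_mem)
  have ipS: "ip (\<lambda>z. z ^ Suc n) (\<lambda>z. z ^ Suc k) = of_nat (Suc k) ^ m * ip (\<lambda>z. z ^ n) (\<lambda>z. z ^ k)" for n k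
    using adjD[OF mono, of "Suc k" n] ip_scale_right[OF mono mono, of n "of_nat (Suc k) ^ m" k] mem
    unfolding BS by (simp del: of_nat_Suc power_Suc)
  show ?thesis
  \<comment> \<open>The recurrence lowers both exponents together, so k must vary. It ends when one
    exponent is 0, with a nonzero value only if both are; on the diagonal the factors accumulate to
    n!^m.\<close>
  proof (induction n arbitrary: k)
    case 0
    show ?case
    proof (cases k)
      case 0
      then show ?thesis using ip_self_real[OF mono, of 0] by simp
    next
      case (Suc j)
      then show ?thesis using ip0[of j] ip_commute[OF mono mono, of "Suc j" 0] by simp
    qed
  next
    case (Suc n)
    show ?case
    proof (cases k)
      case 0
      then show ?thesis using ip0[of n] by simp
    next
      case (Suc j)
      then show ?thesis
        using ipS[of n j] Suc.IH[of j]
        by (simp add: power_mult_distrib del: of_nat_Suc power_Suc)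
    qed
  qed
qed

text \<open>The weights are c n!^m with c the squared norm of 1. A positive scalar does not affect
  summability, so the membership criterion gives the same set, and Parseval gives proportional inner
  products.\<close>

lemma fock_space_unique:
  assumes "entire_hilbert_space H ip" "dense_in H ip polynomial_functions"
    and "adjoint_operator H ip (max_operator H mult_z) = max_operator H (ba_power_b m)"
    and "m \<ge> 1"
  shows "H = fock_space m \<and>
    (\<exists>c::real. c > 0 \<and> (\<forall>f\<in>H. \<forall>g\<in>H. ip f g = of_real c * fock_ip m f g))"
proof -
  define c where "c = Re (ip (\<lambda>z. 1) (\<lambda>z. 1))"
  interpret entire_hilbert_space H ip by fact
  interpret orthogonal_monomials H ip "\<lambda>n. c * fact n ^ m"
    by unfold_locales (use assms(2) adjoint_determines_monomials[OF assms] in \<open>simp_all add: c_def\<close>)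
  have c: "c > 0" using weight_pos[of 0] by simp
  have weights: "summable (\<lambda>n. (norm (taylor_coeff f n))\<^sup>2 * (c * fact n ^ m)) \<longleftrightarrow>
      summable (\<lambda>n. (norm (taylor_coeff f n))\<^sup>2 * fact n ^ m)" for f
    using summable_cmult_iff[of c "\<lambda>n. (norm (taylor_coeff f n))\<^sup>2 * fact n ^ m"] c
    by (simp add: mult.left_commute)
  have H: "H = fock_space m"
    unfolding fock_space_def set_eq_iff mem_iff mem_Collect_eq weights by blast
  have "ip f g = of_real c * fock_ip m f g" if "f \<in> H" "g \<in> H" for f g
  proof -
    have "(\<lambda>n. of_real c * (taylor_coeff f n * cnj (taylor_coeff g n) * fact n ^ m)) sums ip f g"
      using ip_sums[OF that] by (simp add: mult.commute mult.left_commute)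
    moreover have "(\<lambda>n. of_real c * (taylor_coeff f n * cnj (taylor_coeff g n) * fact n ^ m))
        sums (of_real c * fock_ip m f g)"
      using that unfolding H fock_ip_def by (intro sums_mult summable_sums summable_fock_ip)
    ultimately show ?thesis by (rule sums_unique2)
  qed
  with H c show ?thesis by blast
qed

theorem theorem4p2:
  fixes m :: nat
  assumes "m \<ge> 1"
  shows
    "(let F = fock_space m; ip = fock_ip m; D = fock_domain m;
          A = max_operator F mult_z; B = max_operator F (ba_power_b m)
      in densely_defined F ip A \<and> closed_operator F ip A \<and>
         densely_defined F ip B \<and> closed_operator F ip B \<and>
         Domain A = D \<and> Domain B = D \<and> D \<subseteq> F \<and>
         adjoint_operator F ip A = B \<and> Domain (adjoint_operator F ip A) = D) \<and>
     (\<forall>f. f holomorphic_on UNIV \<longrightarrow> ba_power_b m f = stirling_operator m f) \<and>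
     (\<forall>H ip. entire_hilbert_space H ip \<and> dense_in H ip polynomial_functions \<and>
         adjoint_operator H ip (max_operator H mult_z) = max_operator H (ba_power_b m) \<longrightarrow>
         H = fock_space m \<and>
         (\<exists>c::real. c > 0 \<and> (\<forall>f\<in>H. \<forall>g\<in>H. ip f g = of_real c * fock_ip m f g)))"
proof (intro conjI allI impI)
  have closed_mult_z: "closed_operator (fock_space m) (fock_ip m) (max_operator (fock_space m) mult_z)"
    \<comment> \<open>Multiplication by z sends coefficient n - 1 to position n; at n = 0, where
      truncation makes \<open>n - 1\<close> equal to 0, the multiplier 0 supplies the vanishing
      constant term.\<close>
    by (rule closed_max_operator_fock[where c = "\<lambda>n. if n = 0 then 0 else 1" and s = "\<lambda>n. n - 1"])
      (auto simp: mult_z_entire taylor_coeff_mult_z gr0_conv_Suc)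
  have "closed_operator (fock_space m) (fock_ip m) (max_operator (fock_space m) (ba_power_b m))"
    by (rule closed_max_operator_fock[OF ba_power_b_entire taylor_coeff_ba_power_b[OF _ assms]])
  then show "let F = fock_space m; ip = fock_ip m; D = fock_domain m;
          A = max_operator F mult_z; B = max_operator F (ba_power_b m)
      in densely_defined F ip A \<and> closed_operator F ip A \<and>
         densely_defined F ip B \<and> closed_operator F ip B \<and>
         Domain A = D \<and> Domain B = D \<and> D \<subseteq> F \<and>
         adjoint_operator F ip A = B \<and> Domain (adjoint_operator F ip A) = D"
    using closed_mult_z assms
    by (simp add: Let_def densely_defined_def Domain_mult_z Domain_ba_power_b dense_in_fock_domain
        fock_domain_subset adjoint_mult_z_fock)
next
  fix f :: "complex \<Rightarrow> complex" assume "f holomorphic_on UNIV"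
  then show "ba_power_b m f = stirling_operator m f" by (rule ba_power_b_eq_stirling_operator)
next
  fix H ip
  assume "entire_hilbert_space H ip \<and> dense_in H ip polynomial_functions \<and>
    adjoint_operator H ip (max_operator H mult_z) = max_operator H (ba_power_b m)"
  then have *: "H = fock_space m \<and>
      (\<exists>c::real. c > 0 \<and> (\<forall>f\<in>H. \<forall>g\<in>H. ip f g = of_real c * fock_ip m f g))"
    using fock_space_unique assms by blast
  then show "H = fock_space m" ..
  from * show "\<exists>c::real. c > 0 \<and> (\<forall>f\<in>H. \<forall>g\<in>H. ip f g = of_real c * fock_ip m f g)" ..
qed

end
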